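(* Let $\mathbb{F}$ be a field, let $d\ge 1$ and $n_1,\dots,n_d\geq 2$ be integers, and let $A=[a_{i_1,\dots,i_d}]\in\mathbb{F}^{n_1\times\cdots\times n_d}$ be a hypermatrix. Let $\mathbf{d}=\{1,\dots,d\}$, let $\mathbf{i_r}=(i_1<\cdots<i_r)\subset\mathbf{d}$, and let $\mathbf{d}\backslash\mathbf{i_r}$ be its complement, listed increasingly. Let $\sigma=\sigma_{\mathbf{i_r}}\in\mathbf{S}_d$ be the permutation $\mathbf{d}\to(\mathbf{i_r},\mathbf{d}\backslash\mathbf{i_r})$, i.e. $(\sigma(1),\dots,\sigma(d))$ is the list $\mathbf{i_r}$ followed by the list $\mathbf{d}\backslash\mathbf{i_r}$. Put $n_{\mathbf{i_r}}=\prod_{s=1}^r n_{i_s}$ and $n_{\mathbf{d}\backslash\mathbf{i_r}}=\prod_{j\in\mathbf{d}\backslash\mathbf{i_r}}n_j$. Then: (i) (vector form to matrix form) $$M_A^{\mathbf{i_r}\times(\mathbf{d}\backslash\mathbf{i_r})}=\mathbf{V}_r^{\,n_{\mathbf{d}\backslash\mathbf{i_r}}}\left(V_A\left[W^{\sigma}_{[n_1,\dots,n_d]}\right]^{T}\right);$$ (ii) (matrix form to vector form) $$V_A=\left(M_A^{\mathbf{i_r}\times(\mathbf{d}\backslash\mathbf{i_r})}\ltimes\delta^I_{n_{\mathbf{d}\backslash\mathbf{i_r}}}\right)^{T}W^{\sigma}_{[n_1,\dots,n_d]}.$$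
   Context: Write $\langle n\rangle=\{1,\dots,n\}$. A $d$-hypermatrix $A=[a_{i_1,\dots,i_d}]\in\mathbb{F}^{n_1\times\cdots\times n_d}$ is a function $\langle n_1\rangle\times\cdots\times\langle n_d\rangle\to\mathbb{F}$. Matrix expression: for disjoint ordered lists of index positions $\mathbf{r}_1=(p_1,\dots,p_k)$ and $\mathbf{r}_2=(q_1,\dots,q_l)$ whose union is $\langle d\rangle$, $M_A^{\mathbf{r}_1\times\mathbf{r}_2}$ is the $(n_{p_1}\cdots n_{p_k})\times(n_{q_1}\cdots n_{q_l})$ matrix whose rows are indexed by the tuples $(i_{p_1},\dots,i_{p_k})$ in lexicographic order (first entry most significant), whose columns are indexed by the tuples $(i_{q_1},\dots,i_{q_l})$ in lexicographic order, and whose corresponding entry is $a_{i_1,\dots,i_d}$. Empty products equal $1$. $V_A:=M_A^{\emptyset\times\langle d\rangle}$ is the row vector of all entries of $A$ in lexicographic order of $(i_1,\dots,i_d)$. Permutation matrix: $\delta_n^i$ is the $i$-th column of the identity matrix $I_n$. For $\sigma\in\mathbf{S}_d$ and $n=n_1\cdots n_d$, $W^{\sigma}_{[n_1,\dots,n_d]}$ is the $n\times n$ matrix whose column at the lexicographic position of $(k_1,\dots,k_d)\in\langle n_1\rangle\times\cdots\times\langle n_d\rangle$ is $\delta_{n_{\sigma(1)}}^{k_{\sigma(1)}}\otimes\cdots\otimes\delta_{n_{\sigma(d)}}^{k_{\sigma(d)}}$. Row stacking of a vector: for a vector $x$ of length $st$, $\mathbf{V}_r^s(x)$ is the $t\times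 s$ matrix whose $i$-th row is $(x_{(i-1)s+1},\dots,x_{is})$. Semi-tensor product: for an $m\times n$ matrix $A$ and a $p\times q$ matrix $B$, with $t=\mathrm{lcm}(n,p)$, $A\ltimes B:=(A\otimes I_{t/n})(B\otimes I_{t/p})$, where $\otimes$ is the Kronecker product. $\delta_n^I:=[(\delta_n^1)^T,(\delta_n^2)^T,\dots,(\delta_n^n)^T]^T$ is a column vector of length $n^2$. *)

theory Defs
  imports "Jordan_Normal_Form.Matrix" "HOL-Combinatorics.Permutations"
begin

text \<open>
  Matrices are the 0-based ones of \<^theory>\<open>Jordan_Normal_Form.Matrix\<close>. Accordingly every index range
  \<open>{1,...,n}\<close> becomes \<open>{0,...,n-1}\<close> and the index positions \<open>{1,...,d}\<close> become \<open>{0,...,d-1}\<close>.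
  A list \<open>ns\<close> of length \<open>d\<close> holds the dimensions \<open>n_1,...,n_d\<close>. A hypermatrix of that format is
  a function on index tuples (lists of length \<open>d\<close>); its values outside of the index box
  are never inspected.
\<close>

type_synonym 'a hypermatrix = "nat list \<Rightarrow> 'a"

text \<open>All index tuples of a box, in lexicographic order with the first entry most significant.\<close>

definition index_tuples :: "nat list \<Rightarrow> nat list list" where
  "index_tuples ns = product_lists (map (\<lambda>n. [0..<n]) ns)"

lemma length_index_tuples: "length (index_tuples ns) = prod_list ns"
  by (induction ns)
    (simp_all add: index_tuples_def length_concat comp_def map_replicate_const sum_list_replicate)

lemma set_index_tuples:
  "ks \<in> set (index_tuples ns) \<longleftrightarrow> length ks = length ns \<and> (\<forall>i < length ns. ks ! i < ns ! i)"
  by (auto simp: index_tuples_def product_lists_set list_all2_conv_all_nth)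

lemma sorted_index_tuples:
  "sorted_wrt (\<lambda>x y. (x, y) \<in> lexord {(a, b). a < b}) (index_tuples ns)"
proof (induction ns)
  case Nil
  show ?case by (simp add: index_tuples_def)
next
  case (Cons n ns)
  have "sorted_wrt (\<lambda>x y. (x, y) \<in> lexord {(a, b). a < b})
      (concat (map (\<lambda>x. map (Cons x) (index_tuples ns)) xs))"
    if "sorted_wrt (<) xs" for xs :: "nat list"
    using that Cons.IH by (induction xs) (auto simp: sorted_wrt_append sorted_wrt_map)
  from this[of "[0..<n]"] show ?case
    by (simp add: index_tuples_def sorted_wrt_upt)
qed

definition dim_prod :: "nat list \<Rightarrow> nat list \<Rightarrow> nat" where
  "dim_prod ns ps = prod_list (map (\<lambda>p. ns ! p) ps)"

text \<open>
  The full index tuple of length \<open>d\<close> that has the entries \<open>u\<close> at the positions \<open>ps\<close> and the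
  entries \<open>v\<close> at the positions \<open>qs\<close>, where \<open>ps\<close> and \<open>qs\<close> partition the positions.
\<close>

definition merge_index ::
  "nat \<Rightarrow> nat list \<Rightarrow> nat list \<Rightarrow> nat list \<Rightarrow> nat list \<Rightarrow> nat list" where
  "merge_index d ps qs u v = map (\<lambda>i. the (map_of (zip (ps @ qs) (u @ v)) i)) [0..<d]"

definition matrix_expr ::
  "nat list \<Rightarrow> 'a hypermatrix \<Rightarrow> nat list \<Rightarrow> nat list \<Rightarrow> 'a mat" where
  "matrix_expr ns A ps qs = mat (dim_prod ns ps) (dim_prod ns qs)
     (\<lambda>(i, j). A (merge_index (length ns) ps qs
        (index_tuples (map (\<lambda>p. ns ! p) ps) ! i) (index_tuples (map (\<lambda>q. ns ! q) qs) ! j)))"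

text \<open>The vector form is a matrix with a single row.\<close>

definition vector_form :: "nat list \<Rightarrow> 'a hypermatrix \<Rightarrow> 'a mat" where
  "vector_form ns A = matrix_expr ns A [] [0..<length ns]"

definition kron :: "'a :: semiring_0 mat \<Rightarrow> 'a mat \<Rightarrow> 'a mat" where
  "kron A B = mat (dim_row A * dim_row B) (dim_col A * dim_col B)
     (\<lambda>(i, j). A $$ (i div dim_row B, j div dim_col B) * B $$ (i mod dim_row B, j mod dim_col B))"

definition stp :: "'a :: semiring_1 mat \<Rightarrow> 'a mat \<Rightarrow> 'a mat" where
  "stp A B = (let t = lcm (dim_col A) (dim_row B) in
     kron A (1\<^sub>m (t div dim_col A)) * kron B (1\<^sub>m (t div dim_row B)))"

definition delta :: "nat \<Rightarrow> nat \<Rightarrow> 'a :: semiring_1 vec" where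
  "delta n i = col (1\<^sub>m n) i"

definition col_mat :: "'a vec \<Rightarrow> 'a mat" where
  "col_mat v = mat_of_cols (dim_vec v) [v]"

definition delta_stack :: "nat \<Rightarrow> 'a :: semiring_1 mat" where
  "delta_stack n = col_mat (vec_of_list (concat (map (\<lambda>i. list_of_vec (delta n i)) [0..<n])))"

text \<open>
  The unit \<open>1\<^sub>m 1\<close> of the Kronecker product ends the fold; each folded matrix is a single column.
\<close>

definition perm_mat :: "nat list \<Rightarrow> (nat \<Rightarrow> nat) \<Rightarrow> 'a :: semiring_1 mat" where
  "perm_mat ns \<sigma> = mat_of_cols (prod_list ns)
     (map (\<lambda>ks. col (foldr kron
             (map (\<lambda>s. col_mat (delta (ns ! \<sigma> s) (ks ! \<sigma> s))) [0..<length ns]) (1\<^sub>m 1)) 0)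
        (index_tuples ns))"

definition row_stack :: "nat \<Rightarrow> 'a vec \<Rightarrow> 'a mat" where
  "row_stack s x = mat (dim_vec x div s) s (\<lambda>(i, j). x $ (i * s + j))"

definition compl_positions :: "nat \<Rightarrow> nat list \<Rightarrow> nat list" where
  "compl_positions d js = filter (\<lambda>j. j \<notin> set js) [0..<d]"

text \<open>The permutation of \<open>{0,...,d-1}\<close> with value list \<open>js\<close> followed by its complement.\<close>

definition split_perm :: "nat \<Rightarrow> nat list \<Rightarrow> nat \<Rightarrow> nat" where
  "split_perm d js p = (if p < d then (js @ compl_positions d js) ! p else p)"

lemma
  assumes "sorted_wrt (<) js" and "set js \<subseteq> {..<d}"
  shows split_perm_values: "map (split_perm d js) [0..<d] = js @ compl_positions d js"
    and split_perm_permutes: "split_perm d js permutes {..<d}"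
proof -
  let ?l = "js @ compl_positions d js"
  have dist: "distinct ?l"
    using assms(1) strict_sorted_iff by (auto simp: compl_positions_def)
  have set: "set ?l = {..<d}"
    using assms(2) by (auto simp: compl_positions_def)
  have len: "length ?l = d"
    using distinct_card[OF dist] set by simp
  show "map (split_perm d js) [0..<d] = ?l"
    by (rule nth_equalityI) (use len in \<open>simp_all add: split_perm_def\<close>)
  have "bij_betw (\<lambda>p. ?l ! p) {..<d} {..<d}"
    using bij_betw_nth[OF dist _ set[symmetric], of "{..<d}"] len by simp
  then have "bij_betw (split_perm d js) {..<d} {..<d}"
    by (rule bij_betw_cong[THEN iffD1, rotated]) (simp add: split_perm_def)
  then show "split_perm d js permutes {..<d}"
    by (rule bij_imp_permutes) (simp add: split_perm_def)
qed

end

theory Submission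
  imports Defs
begin

text \<open>
  The matrix \<open>W\<close> of the permutation \<open>\<sigma>\<close> only relabels positions. Its column at the lexicographic
  position of \<open>ks\<close> is a Kronecker product of unit vectors, hence again a unit vector, and the
  position of its entry \<open>1\<close> is the lexicographic position of the permuted tuple
  \<open>(ks ! \<sigma> 0, ..., ks ! \<sigma> (d - 1))\<close> in the permuted box: the rule for the position of the entry \<open>1\<close> in a
  Kronecker product of two unit vectors is Horner's rule for the mixed-radix number that a tuple
  denotes (\<open>foldr_kron_delta\<close>, \<open>perm_mat_entry\<close>).

  Therefore \<open>V W\<^sup>T\<close> lists the entries of the hypermatrix in the lexicographic order of the permuted
  tuples. When \<open>\<sigma>\<close> puts the row positions before the column positions, a permuted tuple is a row
  tuple followed by a column tuple, and its position is \<open>i * s + j\<close>, where \<open>i\<close> and \<open>j\<close> are the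
  positions of the two parts and \<open>s\<close> is the number of columns (\<open>lex_pos_append\<close>). This is the
  indexing of a row stacking, which gives the first claim.

  For the second claim, the semi-tensor product with the stacked unit vectors undoes row stacking
  (\<open>stp_row_stack_delta_stack\<close>), so it turns the matrix form into the column \<open>(V W\<^sup>T)\<^sup>T\<close>. Since
  distinct tuples have distinct positions, the columns of \<open>W\<close> are distinct unit vectors, so
  \<open>W\<^sup>T W = I\<close> (\<open>perm_mat_orthogonal\<close>) and \<open>V W\<^sup>T W = V\<close>.
\<close>

section \<open>Lexicographic positions\<close>

text \<open>
  The number that \<open>ks\<close> denotes in the mixed-radix system with the digit ranges \<open>ns\<close>. The last
  equation matters for the empty tuple, which is the only tuple of the empty box.
\<close>

fun lex_pos :: "nat list \<Rightarrow> nat list \<Rightarrow> nat" where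
  "lex_pos (n # ns) (k # ks) = k * prod_list ns + lex_pos ns ks"
| "lex_pos _ _ = 0"

lemma digit_pair_less:
  fixes i j m n :: nat
  assumes "i < m" and "j < n"
  shows "i * n + j < m * n"
proof -
  have "i * n + j < Suc i * n" using assms(2) by simp
  also have "\<dots> \<le> m * n" using assms(1) by (intro mult_le_mono1) simp
  finally show ?thesis .
qed

lemma nth_concat_equal_lengths:
  assumes "\<forall>xs \<in> set xss. length xs = m" and "i < length xss" and "j < m"
  shows "concat xss ! (i * m + j) = xss ! i ! j"
  using assms
proof (induction xss arbitrary: i)
  case (Cons xs xss)
  then show ?case by (cases i) (simp_all add: nth_append)
qed simp

lemma index_tuples_Cons:
  "index_tuples (n # ns) = concat (map (\<lambda>k. map ((#) k) (index_tuples ns)) [0..<n])"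
  by (simp add: index_tuples_def)

lemma lex_pos_less:
  assumes "ks \<in> set (index_tuples ns)"
  shows "lex_pos ns ks < prod_list ns"
  using assms
proof (induction ns ks rule: lex_pos.induct)
  case (1 n ns k ks)
  then have "k < n" and "lex_pos ns ks < prod_list ns"
    by (auto simp: index_tuples_Cons)
  then show ?case by (simp add: digit_pair_less)
qed (auto simp: set_index_tuples index_tuples_def[of "[]"])

text \<open>
  The tuples with first entry \<open>k\<close> form the block number \<open>k\<close> of the enumeration, and all blocks have
  the size \<open>prod_list ns\<close> by which \<open>lex_pos\<close> weights the first entry.
\<close>

lemma nth_lex_pos:
  assumes "ks \<in> set (index_tuples ns)"
  shows "index_tuples ns ! lex_pos ns ks = ks"
  using assms
proof (induction ns ks rule: lex_pos.induct)
  case (1 n ns k ks)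
  then have "k < n" and ks: "ks \<in> set (index_tuples ns)"
    by (auto simp: index_tuples_Cons)
  then show ?case
    using 1 lex_pos_less[OF ks]
    by (simp add: index_tuples_Cons nth_concat_equal_lengths length_index_tuples)
qed (auto simp: set_index_tuples index_tuples_def[of "[]"])

lemma lex_pos_inj:
  assumes "ks \<in> set (index_tuples ns)" and "ks' \<in> set (index_tuples ns)"
  shows "lex_pos ns ks = lex_pos ns ks' \<longleftrightarrow> ks = ks'"
  using nth_lex_pos assms by metis

text \<open>Lexicographic sortedness makes the enumeration free of repetitions.\<close>

lemma distinct_index_tuples: "distinct (index_tuples ns)"
proof -
  have "irrefl {(a, b :: nat). a < b}" by (auto simp: irrefl_def)
  then have "(ks, ks) \<notin> lexord {(a, b). a < b}" for ks :: "nat list"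
    by (simp add: lexord_irreflexive)
  then show ?thesis
    using sorted_index_tuples[of ns]
    unfolding distinct_conv_nth sorted_wrt_iff_nth_less by (metis nat_neq_iff)
qed

lemma lex_pos_nth:
  assumes "c < prod_list ns"
  shows "lex_pos ns (index_tuples ns ! c) = c"
proof -
  let ?ks = "index_tuples ns ! c"
  have "?ks \<in> set (index_tuples ns)" using assms by (simp add: length_index_tuples)
  then have "index_tuples ns ! lex_pos ns ?ks = ?ks" and "lex_pos ns ?ks < prod_list ns"
    by (simp_all add: nth_lex_pos lex_pos_less)
  then show ?thesis
    using assms distinct_index_tuples nth_eq_iff_index_eq by (metis length_index_tuples)
qed

text \<open>
  This turns a pair of row and column positions into a position in the concatenated box; the weight
  of the first part is the number of columns.
\<close>

lemma lex_pos_append: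
  assumes "length ms = length u"
  shows "lex_pos (ms @ ns) (u @ v) = lex_pos ms u * prod_list ns + lex_pos ns v"
  using assms by (induction ms u rule: list_induct2) (simp_all add: algebra_simps)

section \<open>The permutation matrix\<close>

text \<open>
  An entry of the product is nonzero only if the quotient of its row index by \<open>m\<close> is \<open>k\<close> and the
  remainder is \<open>l\<close>; this is one Horner step.
\<close>

lemma kron_delta:
  assumes "k < n" and "l < m"
  shows "kron (col_mat (delta n k)) (col_mat (delta m l)) =
    (col_mat (delta (n * m) (k * m + l)) :: 'a :: semiring_1 mat)"
proof (rule eq_matI)
  fix i j
  assume "i < dim_row (col_mat (delta (n * m) (k * m + l)) :: 'a mat)"
    and "j < dim_col (col_mat (delta (n * m) (k * m + l)) :: 'a mat)"
  then have i: "i < n * m" and j: "j = 0"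
    by (simp_all add: col_mat_def delta_def)
  have m: "0 < m" using assms by simp
  have div: "i div m < n" using i by (simp add: less_mult_imp_div_less)
  have kl: "k * m + l < n * m" using assms by (rule digit_pair_less)
  have "i = k * m + l \<longleftrightarrow> i div m = k \<and> i mod m = l"
    using assms(2) by (metis div_mult_mod_eq div_mult_self3 mod_mult_self3 div_less mod_less
        add.commute add.right_neutral less_nat_zero_code)
  then show "kron (col_mat (delta n k)) (col_mat (delta m l)) $$ (i, j) =
      (col_mat (delta (n * m) (k * m + l)) :: 'a mat) $$ (i, j)"
    using i j m div assms kl
    by (auto simp: kron_def col_mat_def delta_def mat_of_cols_index)
qed (simp_all add: kron_def col_mat_def delta_def)

lemma foldr_kron_delta:
  assumes "\<forall>s \<in> set xs. k s < n s"
  shows "foldr kron (map (\<lambda>s. col_mat (delta (n s) (k s))) xs) (1\<^sub>m 1) =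
    (col_mat (delta (prod_list (map n xs)) (lex_pos (map n xs) (map k xs))) :: 'a :: semiring_1 mat)"
  using assms
proof (induction xs)
  case Nil
  show ?case by (rule eq_matI) (auto simp: col_mat_def delta_def mat_of_cols_index)
next
  case (Cons x xs)
  have "map k xs \<in> set (index_tuples (map n xs))"
    using Cons.prems by (simp add: set_index_tuples)
  then have "lex_pos (map n xs) (map k xs) < prod_list (map n xs)"
    by (rule lex_pos_less)
  then show ?case using Cons by (simp add: kron_delta)
qed

abbreviation permuted :: "(nat \<Rightarrow> nat) \<Rightarrow> nat list \<Rightarrow> nat list" where
  "permuted \<sigma> xs \<equiv> map (\<lambda>s. xs ! \<sigma> s) [0..<length xs]"

lemma prod_list_permuted:
  assumes "\<sigma> permutes {..<length ns}"
  shows "prod_list (permuted \<sigma> ns) = prod_list ns"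
  using prod.permute[OF assms, of "\<lambda>i. ns ! i"]
  by (simp add: prod.list_conv_set_nth atLeast0LessThan comp_def)

lemma permuted_index_tuple:
  assumes "\<sigma> permutes {..<length ns}" and "ks \<in> set (index_tuples ns)"
  shows "permuted \<sigma> ks \<in> set (index_tuples (permuted \<sigma> ns))"
  using assms permutes_in_image[OF assms(1)] by (simp add: set_index_tuples)

lemma permuted_inj:
  assumes "\<sigma> permutes {..<d}" and "length ks = d" and "length ks' = d"
  shows "permuted \<sigma> ks = permuted \<sigma> ks' \<longleftrightarrow> ks = ks'"
proof
  assume "permuted \<sigma> ks = permuted \<sigma> ks'"
  then have "ks ! \<sigma> s = ks' ! \<sigma> s" if "s < d" for s using that assms by simp
  then have "ks ! i = ks' ! i" if "i < d" for i
    using that permutes_image[OF assms(1)] by (metis imageE lessThan_iff)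
  then show "ks = ks'" using assms by (simp add: nth_equalityI)
qed simp

lemma dim_perm_mat [simp]:
  "dim_row (perm_mat ns \<sigma>) = prod_list ns" "dim_col (perm_mat ns \<sigma>) = prod_list ns"
  by (simp_all add: perm_mat_def length_index_tuples)

lemma perm_mat_entry:
  assumes "\<sigma> permutes {..<length ns}" and "r < prod_list ns" and "c < prod_list ns"
  shows "(perm_mat ns \<sigma> :: 'a :: semiring_1 mat) $$ (r, c) =
    of_bool (r = lex_pos (permuted \<sigma> ns) (permuted \<sigma> (index_tuples ns ! c)))"
proof -
  let ?ks = "index_tuples ns ! c"
  have ks: "?ks \<in> set (index_tuples ns)" using assms(3) by (simp add: length_index_tuples)
  then have len: "length ?ks = length ns" by (simp add: set_index_tuples)
  let ?p = "lex_pos (permuted \<sigma> ns) (permuted \<sigma> ?ks)"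
  have p: "?p < prod_list ns"
    using lex_pos_less[OF permuted_index_tuple[OF assms(1) ks]] prod_list_permuted[OF assms(1)]
    by simp
  have "\<forall>s \<in> set [0..<length ns]. ?ks ! \<sigma> s < ns ! \<sigma> s"
    using ks permutes_in_image[OF assms(1)] by (simp add: set_index_tuples)
  then have "foldr kron (map (\<lambda>s. col_mat (delta (ns ! \<sigma> s) (?ks ! \<sigma> s))) [0..<length ns]) (1\<^sub>m 1)
      = (col_mat (delta (prod_list ns) ?p) :: 'a mat)"
    using prod_list_permuted[OF assms(1)] len by (subst foldr_kron_delta) simp_all
  then show ?thesis
    using assms p
    by (simp add: perm_mat_def length_index_tuples mat_of_cols_index col_mat_def delta_def)
qed

text \<open>
  Entry \<open>(c, c')\<close> is the scalar product of two unit columns. It is \<open>1\<close> if their entries \<open>1\<close> sit in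
  the same row, and by injectivity of the relabelling that happens only for \<open>c = c'\<close>.
\<close>

lemma perm_mat_orthogonal:
  assumes "\<sigma> permutes {..<length ns}"
  shows "transpose_mat (perm_mat ns \<sigma>) * perm_mat ns \<sigma> = (1\<^sub>m (prod_list ns) :: 'a :: semiring_1 mat)"
proof (rule eq_matI)
  fix c c'
  assume "c < dim_row (1\<^sub>m (prod_list ns) :: 'a mat)" "c' < dim_col (1\<^sub>m (prod_list ns) :: 'a mat)"
  then have c: "c < prod_list ns" "c' < prod_list ns" by simp_all
  let ?t = "\<lambda>c. index_tuples ns ! c"
  let ?p = "\<lambda>c. lex_pos (permuted \<sigma> ns) (permuted \<sigma> (?t c))"
  have t: "?t c \<in> set (index_tuples ns)" "?t c' \<in> set (index_tuples ns)"
    using c by (simp_all add: length_index_tuples)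
  then have len: "length (?t c) = length ns" "length (?t c') = length ns"
    by (simp_all add: set_index_tuples)
  have less: "?p c < prod_list ns"
    using lex_pos_less[OF permuted_index_tuple[OF assms t(1)]] prod_list_permuted[OF assms] by simp
  have "?p c = ?p c' \<longleftrightarrow> ?t c = ?t c'"
    using lex_pos_inj permuted_index_tuple[OF assms] permuted_inj[OF assms len] t by metis
  also have "\<dots> \<longleftrightarrow> c = c'"
    using c distinct_index_tuples by (simp add: nth_eq_iff_index_eq length_index_tuples)
  finally have inj: "?p c = ?p c' \<longleftrightarrow> c = c'" .
  have "(transpose_mat (perm_mat ns \<sigma>) * perm_mat ns \<sigma>) $$ (c, c') =
      (\<Sum>r = 0..<prod_list ns. of_bool (r = ?p c) * of_bool (r = ?p c') :: 'a)"
    using c by (simp add: scalar_prod_def perm_mat_entry[OF assms])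
  also have "\<dots> = (\<Sum>r = 0..<prod_list ns. if r = ?p c then of_bool (?p c = ?p c') else 0)"
    by (rule sum.cong) auto
  also have "\<dots> = of_bool (c = c')"
    using less inj by simp
  finally show "(transpose_mat (perm_mat ns \<sigma>) * perm_mat ns \<sigma>) $$ (c, c') =
      (1\<^sub>m (prod_list ns) :: 'a mat) $$ (c, c')"
    using c by simp
qed simp_all

section \<open>Vector form and matrix form\<close>

text \<open>Merging inverts the rearrangement of a tuple according to \<open>ps @ qs\<close>.\<close>

lemma merge_index_nth:
  assumes "distinct (ps @ qs)" and "length ps = length u" and "length qs = length v"
    and "s < length (ps @ qs)" and "(ps @ qs) ! s < d"
  shows "merge_index d ps qs u v ! ((ps @ qs) ! s) = (u @ v) ! s"
  using assms map_of_zip_nth[of "ps @ qs" "u @ v" s] by (simp add: merge_index_def)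

lemma merge_index_all:
  assumes "length v = d"
  shows "merge_index d [] [0..<d] [] v = v"
proof (rule nth_equalityI)
  fix i assume "i < length (merge_index d [] [0..<d] [] v)"
  then show "merge_index d [] [0..<d] [] v ! i = v ! i"
    using merge_index_nth[of "[]" "[0..<d]" "[]" v i d] assms by (simp add: merge_index_def)
qed (use assms in \<open>simp add: merge_index_def\<close>)

lemma dim_vector_form [simp]:
  "dim_row (vector_form ns A) = 1" "dim_col (vector_form ns A) = prod_list ns"
  by (simp_all add: vector_form_def matrix_expr_def dim_prod_def map_nth)

lemma vector_form_entry:
  assumes "c < prod_list ns"
  shows "vector_form ns A $$ (0, c) = A (index_tuples ns ! c)"
proof -
  have "index_tuples ns ! c \<in> set (index_tuples ns)"
    using assms by (simp add: length_index_tuples)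
  then have "length (index_tuples ns ! c) = length ns" by (simp add: set_index_tuples)
  then show ?thesis
    using assms
    by (simp add: vector_form_def matrix_expr_def dim_prod_def map_nth merge_index_all
        index_tuples_def[of "[]"])
qed

text \<open>
  Row \<open>lex_pos (permuted \<sigma> ns) (permuted \<sigma> ks)\<close> of the permutation matrix has its only \<open>1\<close> in the
  column of \<open>ks\<close>, by injectivity of the relabelling.
\<close>

lemma vector_form_times_perm_mat:
  fixes A :: "'a :: semiring_1 hypermatrix"
  assumes "\<sigma> permutes {..<length ns}" and ks: "ks \<in> set (index_tuples ns)"
  shows "(vector_form ns A * transpose_mat (perm_mat ns \<sigma>)) $$
      (0, lex_pos (permuted \<sigma> ns) (permuted \<sigma> ks)) = A ks"
proof -
  let ?t = "\<lambda>c. index_tuples ns ! c"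
  let ?r = "lex_pos (permuted \<sigma> ns) (permuted \<sigma> ks)"
  have r: "?r < prod_list ns"
    using lex_pos_less[OF permuted_index_tuple[OF assms]] prod_list_permuted[OF assms(1)] by simp
  have eq: "?r = lex_pos (permuted \<sigma> ns) (permuted \<sigma> (?t c)) \<longleftrightarrow> c = lex_pos ns ks"
    if c: "c < prod_list ns" for c
  proof -
    have t: "?t c \<in> set (index_tuples ns)" using c by (simp add: length_index_tuples)
    have len: "length ks = length ns" "length (?t c) = length ns"
      using t ks by (simp_all add: set_index_tuples)
    have "?r = lex_pos (permuted \<sigma> ns) (permuted \<sigma> (?t c)) \<longleftrightarrow> ks = ?t c"
      using lex_pos_inj permuted_index_tuple[OF assms(1)] permuted_inj[OF assms(1) len] t ks
      by metis
    then show ?thesis using lex_pos_nth[OF c] nth_lex_pos[OF ks] by auto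
  qed
  have "(vector_form ns A * transpose_mat (perm_mat ns \<sigma>)) $$ (0, ?r) =
      (\<Sum>c = 0..<prod_list ns. A (?t c) * of_bool (c = lex_pos ns ks))"
    using r by (simp add: scalar_prod_def vector_form_entry perm_mat_entry[OF assms(1)] eq)
  also have "\<dots> = (\<Sum>c = 0..<prod_list ns. if c = lex_pos ns ks then A ks else 0)"
    by (rule sum.cong) (auto simp: nth_lex_pos[OF ks])
  also have "\<dots> = A ks" using lex_pos_less[OF ks] by simp
  finally show ?thesis .
qed

text \<open>
  The tuple \<open>ks\<close> at entry \<open>(i, j)\<close> is characterised by its permuted form, the row tuple followed by
  the column tuple, so its position after the relabelling is the index \<open>i * dim_prod ns qs + j\<close>
  that row stacking reads. The number of columns has to be positive because the number of stacked
  rows is a quotient by it.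
\<close>

lemma matrix_expr_row_stack:
  fixes A :: "'a :: semiring_1 hypermatrix"
  assumes perm: "\<sigma> permutes {..<length ns}"
    and vals: "map \<sigma> [0..<length ns] = ps @ qs"
    and pos: "0 < dim_prod ns qs"
  shows "matrix_expr ns A ps qs = row_stack (dim_prod ns qs)
      (row (vector_form ns A * transpose_mat (perm_mat ns \<sigma>)) 0)" (is "?L = row_stack ?s ?x")
proof -
  let ?np = "map ((!) ns) ps" and ?nq = "map ((!) ns) qs"
  let ?d = "length ns"
  have \<sigma>: "\<sigma> s = (ps @ qs) ! s" if "s < ?d" for s
    using vals that by (metis add_0 length_map map_nth nth_map nth_upt diff_zero length_upt)
  have perm_ns: "permuted \<sigma> ns = ?np @ ?nq"
    using arg_cong[OF vals, of "map ((!) ns)"] by (simp add: comp_def)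
  have prod: "prod_list ns = dim_prod ns ps * ?s"
    using prod_list_permuted[OF perm] unfolding perm_ns by (simp add: dim_prod_def)
  have dist: "distinct (ps @ qs)"
    using permutes_inj_on[OF perm] by (simp flip: vals add: distinct_map)
  have len: "length (ps @ qs) = ?d"
    using arg_cong[OF vals, of length] by simp
  have dim: "dim_vec ?x = dim_prod ns ps * ?s" by (simp add: prod)
  show ?thesis
  proof (rule eq_matI)
    fix i j
    assume "i < dim_row (row_stack ?s ?x)" "j < dim_col (row_stack ?s ?x)"
    then have i: "i < dim_prod ns ps" and j: "j < ?s"
      using pos by (simp_all add: row_stack_def prod)
    let ?u = "index_tuples ?np ! i" and ?v = "index_tuples ?nq ! j"
    let ?ks = "merge_index ?d ps qs ?u ?v"
    have u: "?u \<in> set (index_tuples ?np)" and v: "?v \<in> set (index_tuples ?nq)"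
      using i j by (simp_all add: length_index_tuples dim_prod_def)
    then have lens: "length ps = length ?u" "length qs = length ?v"
      by (simp_all add: set_index_tuples)
    have ks_nth: "?ks ! \<sigma> s = (?u @ ?v) ! s" if "s < ?d" for s
      using merge_index_nth[OF dist lens, of s ?d] that len permutes_in_image[OF perm]
      by (simp add: \<sigma>[symmetric])
    have len_ks: "length ?ks = ?d" by (simp add: merge_index_def)
    have perm_ks: "permuted \<sigma> ?ks = ?u @ ?v"
      by (rule nth_equalityI) (use len lens in \<open>simp_all add: len_ks ks_nth\<close>)
    have "(?u @ ?v) ! s < (?np @ ?nq) ! s" if "s < ?d" for s
      using u v that len by (auto simp: set_index_tuples nth_append)
    then have "?ks ! \<sigma> s < ns ! \<sigma> s" if "s < ?d" for s
      using that by (metis (no_types, lifting) ks_nth perm_ns nth_map_upt add_0 diff_zero)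
    then have "?ks ! k < ns ! k" if "k < ?d" for k
      using that permutes_image[OF perm] by (metis imageE lessThan_iff)
    then have ks: "?ks \<in> set (index_tuples ns)" by (simp add: set_index_tuples len_ks)
    have "lex_pos (permuted \<sigma> ns) (permuted \<sigma> ?ks) = i * ?s + j"
      unfolding perm_ks perm_ns using i j lens
      by (simp add: lex_pos_append lex_pos_nth dim_prod_def)
    moreover have "i * ?s + j < prod_list ns" unfolding prod using i j by (rule digit_pair_less)
    ultimately have "?x $ (i * ?s + j) = A ?ks"
      using vector_form_times_perm_mat[OF perm ks, of A] by simp
    then show "?L $$ (i, j) = row_stack ?s ?x $$ (i, j)"
      using i j by (simp add: matrix_expr_def row_stack_def prod)
  qed (use pos in \<open>simp_all add: matrix_expr_def row_stack_def prod\<close>)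
qed

section \<open>Undoing row stacking\<close>

lemma kron_one_right: "kron A (1\<^sub>m 1) = (A :: 'a :: semiring_1 mat)"
  by (rule eq_matI) (simp_all add: kron_def)

lemma dim_delta_stack [simp]: "dim_row (delta_stack n) = n * n" "dim_col (delta_stack n) = 1"
  by (simp_all add: delta_stack_def col_mat_def delta_def length_concat comp_def sum_list_triv)

lemma delta_stack_entry:
  assumes "a < n" and "b < n"
  shows "(delta_stack n :: 'a :: semiring_1 mat) $$ (a * n + b, 0) = of_bool (a = b)"
proof -
  have "a * n + b < n * n" using assms by (rule digit_pair_less)
  then have "(delta_stack n :: 'a mat) $$ (a * n + b, 0) =
      concat (map (\<lambda>i. list_of_vec (delta n i)) [0..<n]) ! (a * n + b)"
    by (simp add: delta_stack_def col_mat_def delta_def mat_of_cols_index vec_of_list_index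
        length_concat comp_def sum_list_triv)
  also have "\<dots> = list_of_vec (delta n a) ! b"
    using assms by (subst nth_concat_equal_lengths) (auto simp: delta_def)
  also have "\<dots> = of_bool (a = b)"
    using assms by (simp add: delta_def list_of_vec_index)
  finally show ?thesis .
qed

lemma sum_digit_pairs:
  fixes f :: "nat \<Rightarrow> 'a :: comm_monoid_add"
  shows "(\<Sum>k = 0..<m * n. f k) = (\<Sum>a = 0..<m. \<Sum>b = 0..<n. f (a * n + b))"
proof -
  have "sum f {a * n..<a * n + n} = (\<Sum>b = 0..<n. f (a * n + b))" for a
    using sum.shift_bounds_nat_ivl[of f 0 "a * n" n] by (simp add: add.commute)
  then show ?thesis
    using sum.nat_group[of f n m] by (simp add: atLeast0LessThan)
qed

text \<open>
  Writing a row index as \<open>i * n + j\<close> and the summation index as \<open>a * n + b\<close>, the Kronecker factor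
  \<open>I\<close> forces \<open>b = j\<close> and the stacked unit vectors force \<open>a = b\<close>, so just the entry \<open>(i, j)\<close>
  survives.
\<close>

lemma stp_row_stack_delta_stack:
  fixes x :: "'a :: semiring_1 vec"
  assumes n: "0 < n" and dim: "dim_vec x = m * n"
  shows "stp (row_stack n x) (delta_stack n) = col_mat x"
proof -
  let ?M = "row_stack n x"
  have M: "dim_row ?M = m" "dim_col ?M = n" using n by (simp_all add: row_stack_def dim)
  \<comment> \<open>Hence the right factor keeps its size, and the left one is inflated by \<open>1\<^sub>m n\<close>.\<close>
  have "lcm n (n * n) = n * n" by (simp add: lcm_proj2_if_dvd)
  then have stp: "stp ?M (delta_stack n) = kron ?M (1\<^sub>m n) * delta_stack n"
    using n by (simp add: stp_def Let_def M kron_one_right flip: One_nat_def)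
  show ?thesis
  proof (rule eq_matI)
    fix r c
    assume "r < dim_row (col_mat x)" "c < dim_col (col_mat x)"
    then have r: "r < m * n" and c: "c = 0" by (simp_all add: col_mat_def dim)
    define i j where "i = r div n" and "j = r mod n"
    have i: "i < m" and j: "j < n"
      using r n by (simp_all add: i_def j_def less_mult_imp_div_less)
    have "(kron ?M (1\<^sub>m n) * delta_stack n) $$ (r, 0) =
        (\<Sum>k = 0..<n * n. kron ?M (1\<^sub>m n) $$ (r, k) * delta_stack n $$ (k, 0))"
      using r by (simp add: scalar_prod_def kron_def M)
    also have "\<dots> = (\<Sum>a = 0..<n. \<Sum>b = 0..<n.
        kron ?M (1\<^sub>m n) $$ (r, a * n + b) * delta_stack n $$ (a * n + b, 0))"
      by (rule sum_digit_pairs)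
    also have "\<dots> = (\<Sum>a = 0..<n. \<Sum>b = 0..<n. if b = j then if a = j then ?M $$ (i, j) else 0 else 0)"
      using r j by (intro sum.cong refl)
        (auto simp: kron_def M digit_pair_less delta_stack_entry simp flip: i_def j_def)
    also have "\<dots> = ?M $$ (i, j)" using j by simp
    also have "\<dots> = x $ r"
      using i j n by (simp add: row_stack_def dim) (simp add: i_def j_def)
    finally show "stp ?M (delta_stack n) $$ (r, c) = col_mat x $$ (r, c)"
      using r by (simp add: stp c col_mat_def mat_of_cols_index dim)
  qed (simp_all add: stp kron_def M col_mat_def dim)
qed

theorem proposition9:
  fixes A :: "'a :: field hypermatrix"
    and d :: nat
    and ns js :: "nat list"
  assumes "d \<ge> 1"
    and "length ns = d"
    and "\<forall>n \<in> set ns. n \<ge> 2"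
    and "sorted_wrt (<) js"
    and "set js \<subseteq> {..<d}"
  shows "matrix_expr ns A js (compl_positions d js) =
           row_stack (dim_prod ns (compl_positions d js))
             (row (vector_form ns A * transpose_mat (perm_mat ns (split_perm d js))) 0) \<and>
         vector_form ns A =
           transpose_mat (stp (matrix_expr ns A js (compl_positions d js))
             (delta_stack (dim_prod ns (compl_positions d js)))) *
           perm_mat ns (split_perm d js)"
proof -
  let ?qs = "compl_positions d js" and ?\<sigma> = "split_perm d js"
  let ?s = "dim_prod ns ?qs" and ?W = "perm_mat ns ?\<sigma> :: 'a mat"
  let ?V = "vector_form ns A"
  let ?x = "row (?V * transpose_mat ?W) 0"
  have perm: "?\<sigma> permutes {..<length ns}"
    using split_perm_permutes[OF assms(4,5)] assms(2) by simp
  have vals: "map ?\<sigma> [0..<length ns] = js @ ?qs"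
    using split_perm_values[OF assms(4,5)] assms(2) by simp
  have "ns ! q \<noteq> 0" if "q \<in> set ?qs" for q
  proof -
    have "ns ! q \<in> set ns" using that assms(2) by (simp add: compl_positions_def)
    then show ?thesis using assms(3) by fastforce
  qed
  then have "?s \<noteq> 0"
    unfolding dim_prod_def prod_list_zero_iff by (metis imageE set_map)
  then have pos: "0 < ?s" by simp
  have matrix: "matrix_expr ns A js ?qs = row_stack ?s ?x"
    using perm vals pos by (rule matrix_expr_row_stack)
  have "prod_list (permuted ?\<sigma> ns) = dim_prod ns js * ?s"
    using arg_cong[OF vals, of "\<lambda>l. prod_list (map ((!) ns) l)"]
    by (simp add: dim_prod_def comp_def)
  then have "dim_vec ?x = dim_prod ns js * ?s"
    using prod_list_permuted[OF perm] by simp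
  then have "stp (matrix_expr ns A js ?qs) (delta_stack ?s) = col_mat ?x"
    using stp_row_stack_delta_stack pos matrix by metis
  moreover have "transpose_mat (col_mat ?x) = ?V * transpose_mat ?W"
    by (rule eq_matI) (simp_all add: col_mat_def mat_of_cols_index)
  moreover have "?V * transpose_mat ?W * ?W = ?V"
  proof -
    have V: "?V \<in> carrier_mat 1 (prod_list ns)" and W: "?W \<in> carrier_mat (prod_list ns) (prod_list ns)"
      by (intro carrier_matI; simp)+
    then have "?V * transpose_mat ?W * ?W = ?V * (transpose_mat ?W * ?W)"
      by (intro assoc_mult_mat) simp_all
    then show ?thesis using V by (simp add: perm_mat_orthogonal[OF perm])
  qed
  ultimately show ?thesis using matrix by simp
qed

end
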